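(* Let $d>0$ be fixed and let $c_d>0$ be an arbitrary constant depending only on $d$. Then for every $\eta>0$ there exists $n_0$ such that for every $n\geq n_0$ the following holds: if $\mathcal{A},\mathcal{B}\subseteq 2^{[n]}$ are set families with $|\mathcal{A}||\mathcal{B}|\geq c_d\, 2^n n^{2d}$, then the number of pairs $(A,B)\in\mathcal{A}\times\mathcal{B}$ with $A\cap B=\varnothing$ is at most $(1+\eta)2^{-2d}|\mathcal{A}||\mathcal{B}|$.
   Context: $2^{[n]}$ denotes the family of all subsets of $[n]=\{1,\dots,n\}$. (The paper phrases the conclusion as "at most $(1+o(1))2^{-2d}|\mathcal{A}||\mathcal{B}|$ disjoint pairs, where $o(1)\to0$ as $n\to\infty$".) *)

theory Defs
  imports Complex_Main
begin

definition disjoint_pairs :: "'a set set \<Rightarrow> 'a set set \<Rightarrow> ('a set \<times> 'a set) set" where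
  "disjoint_pairs \<A> \<B> = {(A, B) \<in> \<A> \<times> \<B>. A \<inter> B = {}}"

end

theory Submission
  imports Defs "HOL-Analysis.Convex" "HOL-Real_Asymp.Real_Asymp"
begin

text \<open>
  Put $r = 1 - \delta$. Splitting the families by membership of one point shows by induction that
  the number of disjoint pairs is at most $K^n (|A| |B|)^r$ as soon as $K$ bounds the two-point sums
  $((1-u)(1-v))^r + ((1-u)v)^r + (u(1-v))^r$ over the unit square. For small $\delta$ one can take
  $K = 2^\delta + \delta\, m^{1 - 1/\delta}$ for any fixed $1 < m < 2$. If the density of disjoint pairs
  exceeds $2^{-L}$, this gives $|A| |B| < 2^{L/\delta} \, 2^n \exp(n\, m^{1 - 1/\delta})$. With
  $m = 2^\sigma$ and $\delta = \sigma^2 / \log_2 n$ the right-hand side is $(1 + o(1))\, 2^n n^{L/\sigma^2}$,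
  which is $o(2^n n^{2d})$ when $L < 2d$ and $\sigma < 1$ is close enough to $1$.
\<close>

section \<open>Tangent-line bounds for powers\<close>

text \<open>Concavity of \<open>t powr (1 - \<delta>)\<close>: the right-hand side is the tangent
  line at \<open>a\<close>. It is weighted AM-GM for \<open>t\<close> and \<open>a\<close>, divided
  by \<open>a powr \<delta>\<close>.\<close>

lemma powr_le_tangent:
  fixes t a \<delta> :: real
  assumes "0 \<le> t" "0 < a" "0 \<le> \<delta>" "\<delta> \<le> 1"
  shows "t powr (1 - \<delta>) \<le> \<delta> * a powr (1 - \<delta>) + (1 - \<delta>) * a powr (- \<delta>) * t"
proof -
  have "t powr (1 - \<delta>) * a powr \<delta> \<le> (1 - \<delta>) * t + \<delta> * a"
    using Youngs_inequality_0[of "1 - \<delta>" \<delta> t a] assms by (cases "t = 0") auto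
  then have "(t powr (1 - \<delta>) * a powr \<delta>) * a powr (- \<delta>) \<le> ((1 - \<delta>) * t + \<delta> * a) * a powr (- \<delta>)"
    by (rule mult_right_mono) simp
  moreover have "a powr \<delta> * a powr (- \<delta>) = 1" "a * a powr (- \<delta>) = a powr (1 - \<delta>)"
    using assms by (simp_all add: powr_minus powr_diff divide_simps)
  ultimately show ?thesis
    by (simp add: distrib_right mult.assoc mult.commute[of t] add.commute split: if_splits)
qed

text \<open>In the tangents at 1/2, taken for \<open>u\<close> and \<open>1 - u\<close>, the linear
  terms in \<open>u\<close> cancel.\<close>

lemma powr_add_powr_le_two_powr:
  fixes u \<delta> :: real
  assumes "0 \<le> u" "u \<le> 1" "0 \<le> \<delta>" "\<delta> \<le> 1"
  shows "(1 - u) powr (1 - \<delta>) + u powr (1 - \<delta>) \<le> 2 powr \<delta>"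
proof -
  have e: "(1/2::real) powr (1 - \<delta>) = 2 powr \<delta> / 2" "(1/2::real) powr (-\<delta>) = 2 powr \<delta>"
    by (simp_all add: powr_divide powr_diff powr_minus divide_simps)
  show ?thesis
    using powr_le_tangent[of u "1/2" \<delta>] powr_le_tangent[of "1 - u" "1/2" \<delta>] assms
    unfolding e by (simp add: algebra_simps)
qed

text \<open>The sum is concave and symmetric about 1/2, hence increasing on [0, 1/2]. Tangents at
  \<open>w\<close> and \<open>1 - w\<close> reduce this to comparing their slopes.\<close>

lemma powr_add_powr_mono:
  fixes u w \<delta> :: real
  assumes "0 \<le> u" "u \<le> w" "0 < w" "w \<le> 1/2" "0 \<le> \<delta>" "\<delta> \<le> 1"
  shows "(1 - u) powr (1 - \<delta>) + u powr (1 - \<delta>) \<le> (1 - w) powr (1 - \<delta>) + w powr (1 - \<delta>)"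
proof -
  have "(1 - w) powr (-\<delta>) \<le> w powr (-\<delta>)"
    using assms by (intro powr_mono2') auto
  then have *: "((1 - \<delta>) * (w - u)) * (1 - w) powr (-\<delta>) \<le> ((1 - \<delta>) * (w - u)) * w powr (-\<delta>)"
    using assms by (intro mult_left_mono) auto
  have e: "w powr (1 - \<delta>) = w * w powr (-\<delta>)" "(1-w) powr (1 - \<delta>) = (1-w) * (1-w) powr (-\<delta>)"
    using assms by (simp_all add: powr_minus powr_diff divide_simps)
  show ?thesis
    using powr_le_tangent[of u w \<delta>] powr_le_tangent[of "1 - u" "1 - w" \<delta>] assms *
    unfolding e by (simp add: algebra_simps)
qed

section \<open>The two-point inequality\<close>

text \<open>Here \<open>u\<close> and \<open>v\<close> stand for the proportions of two families
  whose members contain a given point. The term in \<open>u * v\<close> is absent because two sets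
  sharing the point are not disjoint.\<close>

definition two_point_sum :: "real \<Rightarrow> real \<Rightarrow> real \<Rightarrow> real" where
  "two_point_sum r u v =
    ((1 - u) * (1 - v)) powr r + ((1 - u) * v) powr r + (u * (1 - v)) powr r"

lemma two_point_sum_commute: "two_point_sum r u v = two_point_sum r v u"
  by (simp add: two_point_sum_def mult.commute)

text \<open>
  Linearising the powers of $v$ at $1$ and at $m^{-1/\delta}$ makes the dependence on $v$ a
  linear term, whose sign is controlled by the choice of $m$.
\<close>

lemma two_point_sum_le:
  fixes u v \<delta> m :: real
  assumes uv: "0 \<le> u" "u \<le> 1" "0 \<le> v" "v \<le> 1" and \<delta>: "0 < \<delta>" "\<delta> \<le> 1"
    and m: "0 < m" "(m - 1) * (1 - u) powr (1 - \<delta>) \<le> u powr (1 - \<delta>)"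
  shows "two_point_sum (1 - \<delta>) u v
    \<le> (1 - u) powr (1 - \<delta>) + u powr (1 - \<delta>) + \<delta> * m powr (1 - 1 / \<delta>)"
proof -
  define r where "r = 1 - \<delta>"
  define U where "U = (1 - u) powr r"
  define W where "W = u powr r"
  have r: "0 \<le> r" using \<delta> by (simp add: r_def)
  have v0: "(1 - v) powr r \<le> 1 - r * v"
    using powr_le_tangent[of "1 - v" 1 \<delta>] uv \<delta> by (simp add: r_def algebra_simps)
  \<comment> \<open>The tangency point is chosen so that its power with exponent
    \<open>- \<delta>\<close>, the slope factor, is exactly \<open>m\<close>.\<close>
  have v1: "v powr r \<le> \<delta> * m powr (1 - 1 / \<delta>) + r * m * v"
  proof -
    have "(m powr (- 1 / \<delta>)) powr (1 - \<delta>) = m powr (1 - 1 / \<delta>)"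
      "(m powr (- 1 / \<delta>)) powr (- \<delta>) = m"
      using \<delta> m by (simp_all add: powr_powr diff_divide_distrib)
    then show ?thesis
      using powr_le_tangent[of v "m powr (- 1 / \<delta>)" \<delta>] uv \<delta> m by (simp add: r_def)
  qed
  have U: "0 \<le> U" "U \<le> 1" and W: "0 \<le> W"
    using uv r by (auto simp: U_def W_def intro: powr_le1)
  have "two_point_sum r u v = (1 - v) powr r * (U + W) + v powr r * U"
    using uv by (simp add: two_point_sum_def U_def W_def powr_mult distrib_left distrib_right ac_simps)
  also have "\<dots> \<le> (1 - r * v) * (U + W) + (\<delta> * m powr (1 - 1 / \<delta>) + r * m * v) * U"
    using v0 v1 U W by (intro add_mono mult_right_mono) auto
  also have "\<dots> = U + W + (r * v) * ((m - 1) * U - W) + (\<delta> * m powr (1 - 1 / \<delta>)) * U"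
    by (simp add: algebra_simps)
  also have "\<dots> \<le> U + W + 0 + (\<delta> * m powr (1 - 1 / \<delta>)) * 1"
    using U W r uv m \<delta> by (intro add_mono mult_left_mono mult_nonneg_nonpos) (auto simp: U_def W_def r_def)
  finally show ?thesis by (simp add: U_def W_def r_def)
qed

text \<open>This supplies the hypothesis on \<open>m\<close> in \<open>two_point_sum_le\<close> for
  \<open>m = 1 / (1 - w)\<close> and \<open>u\<close> at least \<open>w\<close>. Then
  \<open>m - 1\<close> is the odds \<open>h = w / (1 - w)\<close>, which satisfies
  \<open>h * (1 - u) \<le> u\<close>; as \<open>h \<le> 1\<close>, replacing \<open>h\<close> by
  \<open>h powr r\<close> only increases it.\<close>

lemma odds_mult_powr_le:
  fixes u w r :: real
  assumes "0 < w" "w \<le> 1/2" "w \<le> u" "u \<le> 1" "0 \<le> r" "r \<le> 1"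
  shows "(1 / (1 - w) - 1) * (1 - u) powr r \<le> u powr r"
proof -
  define h where "h = w / (1 - w)"
  have h: "0 < h" "h \<le> 1" using assms by (auto simp: h_def divide_simps)
  have "h * (1 - u) \<le> u"
  proof -
    have "w * (1 - u) \<le> u * (1 - w)" using assms by (simp add: algebra_simps)
    then show ?thesis using assms by (simp add: h_def divide_simps mult.commute)
  qed
  then have "(h * (1 - u)) powr r \<le> u powr r"
    using assms h by (intro powr_mono2) auto
  then have "h powr r * (1 - u) powr r \<le> u powr r"
    using assms h by (simp add: powr_mult)
  moreover have "h \<le> h powr r"
    using powr_mono'[of r 1 h] assms h by simp
  then have "h * (1 - u) powr r \<le> h powr r * (1 - u) powr r"
    by (rule mult_right_mono) simp
  moreover have "1 / (1 - w) - 1 = h"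
    using assms by (simp add: h_def field_simps)
  ultimately show ?thesis by simp
qed

text \<open>Gibbs' inequality against the uniform distribution. The left side is the first-order
  coefficient in \<delta> of \<open>(1 - w) powr (1 - \<delta>) + w powr (1 - \<delta>)\<close>, and
  \<open>ln 2\<close> is that of \<open>2 powr \<delta>\<close>.\<close>

lemma entropy_less_ln_2:
  fixes w :: real
  assumes "0 < w" "w < 1/2"
  shows "- w * ln w - (1 - w) * ln (1 - w) < ln 2"
proof -
  have less: "ln x < x - 1" if "0 < x" "x \<noteq> 1" for x :: real
    using that ln_le_minus_one[of x] ln_eq_minus_one[of x] by linarith
  have "w * ln (1 / (2 * w)) < w * (1 / (2 * w) - 1)"
    "(1 - w) * ln (1 / (2 * (1 - w))) < (1 - w) * (1 / (2 * (1 - w)) - 1)"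
    using assms by (intro mult_strict_left_mono less; simp)+
  moreover have "w * (1 / (2 * w) - 1) + (1 - w) * (1 / (2 * (1 - w)) - 1) = 0"
    using assms by (simp add: field_simps)
  moreover have ln_half: "ln (1 / (2 * x)) = - ln 2 - ln x" if "0 < x" for x :: real
    using that by (simp add: ln_div ln_mult)
  moreover from ln_half[of w] ln_half[of "1 - w"]
  have "ln (1 / (2 * w)) = - ln 2 - ln w" "ln (1 / (2 * (1 - w))) = - ln 2 - ln (1 - w)"
    using assms by auto
  ultimately have "w * (- ln 2 - ln w) + (1 - w) * (- ln 2 - ln (1 - w)) < 0"
    by (smt (verit))
  then show ?thesis by (simp add: algebra_simps)
qed

text \<open>Up to exchanging \<open>u\<close> and \<open>v\<close> there are three regimes. For
  \<open>u \<ge> w\<close> the linearisation with \<open>m\<close> applies directly. For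
  \<open>1/10 \<le> u < w\<close> it is used with 10/9 instead, whose error fits into the gap below
  \<open>2 powr \<delta>\<close>. If both are at most 1/10, a direct estimate suffices.\<close>

lemma eventually_two_point_sum_le:
  fixes w :: real
  assumes w: "0 < w" "w < 1/2"
  defines "m \<equiv> 1 / (1 - w)"
  shows "\<forall>\<^sub>F \<delta> in at_right 0. \<forall>u v. 0 \<le> u \<longrightarrow> u \<le> 1 \<longrightarrow> 0 \<le> v \<longrightarrow> v \<le> 1 \<longrightarrow>
    two_point_sum (1 - \<delta>) u v \<le> 2 powr \<delta> + \<delta> * m powr (1 - 1 / \<delta>)"
proof -
  \<comment> \<open>Dividing by \<delta> isolates the first-order term, entropy minus
    \<open>ln 2\<close>, which is negative. The term with 10/9 does not affect it, since
    \<open>(10/9) powr (1 - 1 / \<delta>)\<close> tends to 0.\<close>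
  have "((\<lambda>\<delta>. ((1 - w) powr (1 - \<delta>) + w powr (1 - \<delta>) + \<delta> * (10/9) powr (1 - 1 / \<delta>) - 2 powr \<delta>) / \<delta>)
      \<longlongrightarrow> - w * ln w - (1 - w) * ln (1 - w) - ln 2) (at_right 0)"
    using w by real_asymp
  then have "\<forall>\<^sub>F \<delta> in at_right 0.
      ((1 - w) powr (1 - \<delta>) + w powr (1 - \<delta>) + \<delta> * (10/9) powr (1 - 1 / \<delta>) - 2 powr \<delta>) / \<delta> < 0"
    using entropy_less_ln_2[OF w] by (intro order_tendstoD) auto
  moreover have "\<forall>\<^sub>F \<delta>::real in at_right 0.
      (1 + 2 * ((1/10) powr (1 - \<delta>) - (1 - \<delta>) * (1/10)) - 2 powr \<delta>) / \<delta> < 0"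
  proof (rule order_tendstoD(2))
    have "((\<lambda>\<delta>::real. (1 + 2 * (y powr (1 - \<delta>) - (1 - \<delta>) * y) - 2 powr \<delta>) / \<delta>)
        \<longlongrightarrow> 2 * (y - y * ln y) - ln 2) (at_right 0)" if "0 < y" for y :: real
      using that by real_asymp
    from this[of "1/10"]
    show "((\<lambda>\<delta>::real. (1 + 2 * ((1/10) powr (1 - \<delta>) - (1 - \<delta>) * (1/10)) - 2 powr \<delta>) / \<delta>)
        \<longlongrightarrow> 2 * (1/10 - 1/10 * ln (1/10)) - ln 2) (at_right 0)" by simp
    \<comment> \<open>Multiplied by 5, the claim reads 1 + ln 10 < 5 ln 2, that is e < 3.2. This is
      what makes the cutoff 1/10 small enough.\<close>
    have "exp 1 < (32/10::real)" using exp_le by simp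
    then have "1 < ln (32/10::real)" by (subst exp_less_cancel_iff[symmetric]) simp
    also have "\<dots> = ln (2 ^ 5 / 10)" by simp
    also have "\<dots> = ln (2 ^ 5) - ln 10" by (subst ln_div) simp_all
    also have "\<dots> = 5 * ln 2 - ln 10" by (subst ln_realpow) simp_all
    finally show "2 * (1/10 - 1/10 * ln (1/10)) - ln 2 < (0::real)" by (simp add: ln_div)
  qed
  moreover have "\<forall>\<^sub>F \<delta>::real in at_right 0. 0 < \<delta> \<and> \<delta> < 1"
    using eventually_at_right_real[of 0 "1::real"] by simp
  ultimately show ?thesis
  proof eventually_elim
    case (elim \<delta>)
    then have \<delta>: "0 < \<delta>" "\<delta> < 1" by auto
    have mid: "(1 - w) powr (1 - \<delta>) + w powr (1 - \<delta>) + \<delta> * (10/9) powr (1 - 1 / \<delta>) \<le> 2 powr \<delta>"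
      and small: "1 + 2 * ((1/10) powr (1 - \<delta>) - (1 - \<delta>) / 10) \<le> 2 powr \<delta>"
      using elim by (simp_all add: divide_less_0_iff)
    have m: "0 < m" using w by (simp add: m_def)
    have large: "two_point_sum (1 - \<delta>) u v \<le> 2 powr \<delta> + \<delta> * m powr (1 - 1 / \<delta>)"
      if uv: "1/10 \<le> u" "u \<le> 1" "0 \<le> v" "v \<le> 1" for u v
    proof (cases "w \<le> u")
      case True
      then have "(m - 1) * (1 - u) powr (1 - \<delta>) \<le> u powr (1 - \<delta>)"
        unfolding m_def using w uv \<delta> by (intro odds_mult_powr_le) auto
      then show ?thesis
        using two_point_sum_le[of u v \<delta> m] powr_add_powr_le_two_powr[of u \<delta>] uv \<delta> m by simp
    next
      case False
      \<comment> \<open>Since 10/9 = 1 / (1 - 1/10), the cutoff 1/10 takes the place of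
        \<open>w\<close> here. The resulting error is absorbed by \<open>mid\<close>, as
        \<open>u < w\<close>.\<close>
      have "(10/9 - 1) * (1 - u) powr (1 - \<delta>) \<le> u powr (1 - \<delta>)"
        using odds_mult_powr_le[of "1/10" u "1 - \<delta>"] uv \<delta> by simp
      then have "two_point_sum (1 - \<delta>) u v \<le> 2 powr \<delta>"
        using two_point_sum_le[of u v \<delta> "10/9"] powr_add_powr_mono[of u w \<delta>] False uv w \<delta> mid
        by simp
      also have "\<dots> \<le> 2 powr \<delta> + \<delta> * m powr (1 - 1 / \<delta>)"
        using \<delta> by simp
      finally show ?thesis .
    qed
    show ?case
    proof (intro allI impI)
      fix u v :: real
      assume uv: "0 \<le> u" "u \<le> 1" "0 \<le> v" "v \<le> 1"
      consider "1/10 \<le> u" | "1/10 \<le> v" | "u \<le> 1/10" "v \<le> 1/10" by linarith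
      then show "two_point_sum (1 - \<delta>) u v \<le> 2 powr \<delta> + \<delta> * m powr (1 - 1 / \<delta>)"
      proof cases
        case 3
        \<comment> \<open>The tangent at 1/10 has slope at least \<open>1 - \<delta>\<close>, so it
          still increases after \<open>(1 - \<delta>) * x\<close> is subtracted and is largest at
          the endpoint 1/10.\<close>
        have excess: "x powr (1 - \<delta>) - (1 - \<delta>) * x \<le> (1/10) powr (1 - \<delta>) - (1 - \<delta>) / 10"
          if "0 \<le> x" "x \<le> 1/10" for x :: real
        proof -
          have e: "(1/10) powr (1 - \<delta>) = (1/10) powr (- \<delta>) / (10::real)"
            by (simp add: powr_diff powr_minus field_simps)
          have "(1::real) \<le> (1/10) powr (- \<delta>)"
            using \<delta> by (simp add: powr_minus powr_divide ge_one_powr_ge_zero)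
          then have "((1 - \<delta>) * x) * ((1/10) powr (- \<delta>) - 1) \<le> ((1 - \<delta>) * (1/10)) * ((1/10) powr (- \<delta>) - 1)"
            using that \<delta> by (intro mult_right_mono mult_left_mono) auto
          then show ?thesis
            using powr_le_tangent[of x "1/10" \<delta>] that \<delta> unfolding e by (simp add: algebra_simps)
        qed
        have one_minus: "(1 - x) powr (1 - \<delta>) \<le> 1 - (1 - \<delta>) * x" if "0 \<le> x" "x \<le> 1" for x :: real
          using powr_le_tangent[of "1 - x" 1 \<delta>] that \<delta> by (simp add: algebra_simps)
        have le1: "x powr (1 - \<delta>) \<le> 1" if "0 \<le> x" "x \<le> 1" for x :: real
          using that \<delta> by (intro powr_le1) auto
        have self_le: "x \<le> x powr (1 - \<delta>)" if "0 \<le> x" "x \<le> 1" for x :: real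
          using powr_mono'[of "1 - \<delta>" 1 x] that \<delta> by simp
        define S where "S = (1 - u) powr (1 - \<delta>) + u powr (1 - \<delta>)"
        have S: "1 \<le> S" "S \<le> 1 - (1 - \<delta>) * u + u powr (1 - \<delta>)"
          using self_le[of u] self_le[of "1 - u"] one_minus[of u] uv by (simp_all add: S_def)
        have "two_point_sum (1 - \<delta>) u v = (1 - v) powr (1 - \<delta>) * S + v powr (1 - \<delta>) * (1 - u) powr (1 - \<delta>)"
          using uv by (simp add: two_point_sum_def S_def powr_mult distrib_left distrib_right ac_simps)
        also have "\<dots> \<le> (1 - (1 - \<delta>) * v) * S + v powr (1 - \<delta>) * 1"
          using S uv by (intro add_mono mult_right_mono mult_left_mono one_minus le1) auto
        also have "\<dots> = S - ((1 - \<delta>) * v) * S + v powr (1 - \<delta>)"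
          by (simp add: algebra_simps)
        \<comment> \<open>Using \<open>1 \<le> S\<close> in the negative term decouples
          \<open>u\<close> from \<open>v\<close>.\<close>
        also have "\<dots> \<le> S - ((1 - \<delta>) * v) * 1 + v powr (1 - \<delta>)"
          using S uv \<delta> by (intro add_right_mono diff_left_mono mult_left_mono) auto
        also have "\<dots> \<le> 1 + (u powr (1 - \<delta>) - (1 - \<delta>) * u) + (v powr (1 - \<delta>) - (1 - \<delta>) * v)"
          using S(2) by simp
        also have "\<dots> \<le> 1 + ((1/10) powr (1 - \<delta>) - (1 - \<delta>) / 10) + ((1/10) powr (1 - \<delta>) - (1 - \<delta>) / 10)"
          using uv 3 by (intro add_mono excess) auto
        also have "\<dots> \<le> 2 powr \<delta>"
          using small by (simp only: mult_2 add.assoc)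
        also have "\<dots> \<le> 2 powr \<delta> + \<delta> * m powr (1 - 1 / \<delta>)"
          using \<delta> by simp
        finally show ?thesis .
      qed (use large[of u v] large[of v u] uv two_point_sum_commute[of _ u v] in auto)
    qed
  qed
qed

section \<open>Induction over the ground set\<close>

text \<open>Homogeneous form of the two-point bound, as the induction step needs it: dividing by the
  totals \<open>a0 + a1\<close> and \<open>b0 + b1\<close> leaves proportions in the unit
  square.\<close>

lemma two_point_sum_scaled:
  fixes a0 a1 b0 b1 r K :: real
  assumes nonneg: "0 \<le> a0" "0 \<le> a1" "0 \<le> b0" "0 \<le> b1"
    and K: "\<And>u v. \<lbrakk>0 \<le> u; u \<le> 1; 0 \<le> v; v \<le> 1\<rbrakk> \<Longrightarrow> two_point_sum r u v \<le> K"
  shows "(a0 * b0) powr r + (a0 * b1) powr r + (a1 * b0) powr r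
    \<le> K * ((a0 + a1) * (b0 + b1)) powr r"
proof (cases "a0 + a1 = 0 \<or> b0 + b1 = 0")
  case True
  \<comment> \<open>If a total is zero, both sides vanish because
    \<open>0 powr r = 0\<close>.\<close>
  then show ?thesis using nonneg by (auto simp: add_nonneg_eq_0_iff)
next
  case False
  define a b u v where "a = a0 + a1" and "b = b0 + b1" and "u = a1 / a" and "v = b1 / b"
  have ab: "0 < a" "0 < b" using False nonneg by (auto simp: a_def b_def)
  then have uv: "0 \<le> u" "u \<le> 1" "0 \<le> v" "v \<le> 1"
    using nonneg by (auto simp: u_def v_def a_def b_def)
  have e: "a1 = a * u" "a0 = a * (1 - u)" "b1 = b * v" "b0 = b * (1 - v)"
    using ab by (simp_all add: u_def v_def right_diff_distrib) (simp_all add: a_def b_def)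
  have "(a0 * b0) powr r + (a0 * b1) powr r + (a1 * b0) powr r = two_point_sum r u v * (a * b) powr r"
    unfolding e two_point_sum_def using ab uv by (simp add: powr_mult distrib_left distrib_right ac_simps)
  also have "\<dots> \<le> K * (a * b) powr r"
    using K uv by (intro mult_right_mono) auto
  finally show ?thesis by (simp add: a_def b_def)
qed

lemma finite_disjoint_pairs: "finite \<A> \<Longrightarrow> finite \<B> \<Longrightarrow> finite (disjoint_pairs \<A> \<B>)"
  by (rule finite_subset[of _ "\<A> \<times> \<B>"]) (auto simp: disjoint_pairs_def)

lemma card_disjoint_pairs_le_product:
  assumes "finite \<A>" "finite \<B>"
  shows "card (disjoint_pairs \<A> \<B>) \<le> card \<A> * card \<B>"
  unfolding card_cartesian_product[symmetric]
  using assms by (intro card_mono) (auto simp: disjoint_pairs_def)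

lemma card_split_by_member:
  assumes "finite \<A>"
  shows "card \<A> = card {A \<in> \<A>. x \<notin> A} + card ((\<lambda>A. A - {x}) ` {A \<in> \<A>. x \<in> A})"
proof -
  have "card ((\<lambda>A. A - {x}) ` {A \<in> \<A>. x \<in> A}) = card {A \<in> \<A>. x \<in> A}"
    by (rule card_image) (auto simp: inj_on_def)
  moreover have "card ({A \<in> \<A>. x \<notin> A} \<union> {A \<in> \<A>. x \<in> A}) = card {A \<in> \<A>. x \<notin> A} + card {A \<in> \<A>. x \<in> A}"
    using assms by (intro card_Un_disjoint) auto
  moreover have "{A \<in> \<A>. x \<notin> A} \<union> {A \<in> \<A>. x \<in> A} = \<A>" by auto
  ultimately show ?thesis by simp
qed

text \<open>In a disjoint pair \<open>x\<close> lies in neither set, only in the second, or only in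
  the first. Putting \<open>x\<close> back recovers the pair in each of the last two cases.\<close>

lemma card_disjoint_pairs_split_by_member:
  fixes \<A> \<B> :: "'a set set" and x :: 'a
  assumes fin: "finite \<A>" "finite \<B>"
  defines "\<A>0 \<equiv> {A \<in> \<A>. x \<notin> A}" and "\<A>1 \<equiv> (\<lambda>A. A - {x}) ` {A \<in> \<A>. x \<in> A}"
    and "\<B>0 \<equiv> {B \<in> \<B>. x \<notin> B}" and "\<B>1 \<equiv> (\<lambda>B. B - {x}) ` {B \<in> \<B>. x \<in> B}"
  shows "card (disjoint_pairs \<A> \<B>) \<le>
    card (disjoint_pairs \<A>0 \<B>0) + card (disjoint_pairs \<A>0 \<B>1) + card (disjoint_pairs \<A>1 \<B>0)"
proof -
  let ?f = "\<lambda>(A, B). (A, insert x B)" and ?g = "\<lambda>(A, B). (insert x A, B)"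
  have "disjoint_pairs \<A> \<B> \<subseteq> disjoint_pairs \<A>0 \<B>0 \<union>
      ?f ` disjoint_pairs \<A>0 \<B>1 \<union> ?g ` disjoint_pairs \<A>1 \<B>0"
  proof (rule subsetI, clarify)
    fix A B
    assume AB: "(A, B) \<in> disjoint_pairs \<A> \<B>"
      and g: "(A, B) \<notin> ?g ` disjoint_pairs \<A>1 \<B>0" and f: "(A, B) \<notin> ?f ` disjoint_pairs \<A>0 \<B>1"
    have "x \<notin> A"
    proof
      assume "x \<in> A"
      then have "(A - {x}, B) \<in> disjoint_pairs \<A>1 \<B>0" "(A, B) = ?g (A - {x}, B)"
        using AB by (auto simp: disjoint_pairs_def \<A>1_def \<B>0_def)
      then show False using g by blast
    qed
    moreover have "x \<notin> B"
    proof
      assume "x \<in> B"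
      then have "(A, B - {x}) \<in> disjoint_pairs \<A>0 \<B>1" "(A, B) = ?f (A, B - {x})"
        using AB by (auto simp: disjoint_pairs_def \<A>0_def \<B>1_def)
      then show False using f by blast
    qed
    ultimately show "(A, B) \<in> disjoint_pairs \<A>0 \<B>0"
      using AB by (auto simp: disjoint_pairs_def \<A>0_def \<B>0_def)
  qed
  moreover have fins: "finite (disjoint_pairs \<A>0 \<B>0)" "finite (disjoint_pairs \<A>0 \<B>1)"
      "finite (disjoint_pairs \<A>1 \<B>0)"
    using fin by (auto intro!: finite_disjoint_pairs simp: \<A>0_def \<A>1_def \<B>0_def \<B>1_def)
  ultimately have "card (disjoint_pairs \<A> \<B>) \<le> card (disjoint_pairs \<A>0 \<B>0 \<union>
      ?f ` disjoint_pairs \<A>0 \<B>1 \<union> ?g ` disjoint_pairs \<A>1 \<B>0)"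
    by (intro card_mono) auto
  also have "\<dots> \<le> card (disjoint_pairs \<A>0 \<B>0) + card (?f ` disjoint_pairs \<A>0 \<B>1)
      + card (?g ` disjoint_pairs \<A>1 \<B>0)"
    by (meson add_le_mono1 card_Un_le order_trans)
  also have "\<dots> \<le> card (disjoint_pairs \<A>0 \<B>0) + card (disjoint_pairs \<A>0 \<B>1) + card (disjoint_pairs \<A>1 \<B>0)"
    using fins by (intro add_mono card_image_le) auto
  finally show ?thesis .
qed

text \<open>Each point of the ground set costs one factor \<open>K\<close>: split both families by
  membership of it, apply the induction hypothesis to the three kinds of pairs, and recombine by the
  two-point bound.\<close>

lemma card_disjoint_pairs_le_powr:
  fixes r K :: real
  assumes "finite X" "\<A> \<subseteq> Pow X" "\<B> \<subseteq> Pow X"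
    and K: "\<And>u v. \<lbrakk>0 \<le> u; u \<le> 1; 0 \<le> v; v \<le> 1\<rbrakk> \<Longrightarrow> two_point_sum r u v \<le> K"
  shows "real (card (disjoint_pairs \<A> \<B>)) \<le> K ^ card X * (real (card \<A>) * real (card \<B>)) powr r"
  using assms(1-3)
proof (induction X arbitrary: \<A> \<B> rule: finite_induct)
  case empty
  \<comment> \<open>Over the empty ground set the product of the sizes is 0 or 1, hence equal to its
    own power with exponent \<open>r\<close>.\<close>
  then have "\<A> \<in> {{}, {{}}}" "\<B> \<in> {{}, {{}}}" by auto
  then show ?case
    using card_disjoint_pairs_le_product[of \<A> \<B>] by auto
next
  case (insert x X)
  have "0 \<le> two_point_sum r 0 0" by (simp add: two_point_sum_def)
  then have K0: "0 \<le> K" using K[of 0 0] by simp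
  define A0 A1 B0 B1 where "A0 = {A \<in> \<A>. x \<notin> A}" and "A1 = (\<lambda>A. A - {x}) ` {A \<in> \<A>. x \<in> A}"
    and "B0 = {B \<in> \<B>. x \<notin> B}" and "B1 = (\<lambda>B. B - {x}) ` {B \<in> \<B>. x \<in> B}"
  note defs = A0_def A1_def B0_def B1_def
  have sub: "A0 \<subseteq> Pow X" "A1 \<subseteq> Pow X" "B0 \<subseteq> Pow X" "B1 \<subseteq> Pow X"
    using insert.prems insert.hyps by (auto simp: defs)
  have fin: "finite \<A>" "finite \<B>"
    using insert.prems insert.hyps by (auto intro: finite_subset[of _ "Pow (insert x X)"])
  have cards: "card \<A> = card A0 + card A1" "card \<B> = card B0 + card B1"
    unfolding defs by (rule card_split_by_member[OF fin(1)], rule card_split_by_member[OF fin(2)])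
  have "real (card (disjoint_pairs \<A> \<B>))
      \<le> card (disjoint_pairs A0 B0) + card (disjoint_pairs A0 B1) + card (disjoint_pairs A1 B0)"
    using card_disjoint_pairs_split_by_member[OF fin, of x] by (simp add: defs flip: of_nat_add)
  also have "\<dots> \<le> K ^ card X * (real (card A0) * real (card B0)) powr r
      + K ^ card X * (real (card A0) * real (card B1)) powr r
      + K ^ card X * (real (card A1) * real (card B0)) powr r"
    using insert.IH[OF sub(1,3)] insert.IH[OF sub(1,4)] insert.IH[OF sub(2,3)] by linarith
  also have "\<dots> = K ^ card X * ((real (card A0) * real (card B0)) powr r
      + (real (card A0) * real (card B1)) powr r + (real (card A1) * real (card B0)) powr r)"
    by (simp add: algebra_simps)
  also have "\<dots> \<le> K ^ card X *
      (K * ((real (card A0) + real (card A1)) * (real (card B0) + real (card B1))) powr r)"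
    using K K0 by (intro mult_left_mono two_point_sum_scaled) auto
  also have "\<dots> = K ^ card (insert x X) * (real (card \<A>) * real (card \<B>)) powr r"
    using insert.hyps by (simp add: cards)
  finally show ?case .
qed

section \<open>From density to a bound on the sizes\<close>

text \<open>The density assumption and the inductive upper bound compare \<open>P\<close> with
  \<open>P powr (1 - \<delta>)\<close>, leaving a bound on \<open>P powr \<delta>\<close>. After
  \<open>1 + x \<le> exp x\<close> has simplified \<open>K ^ n\<close>, the root with exponent
  \<open>1 / \<delta>\<close> is taken.\<close>

lemma card_product_less:
  fixes \<delta> m L :: real and n :: nat
  assumes sub: "\<A> \<subseteq> Pow {1..n}" "\<B> \<subseteq> Pow {1..n}" and \<delta>: "0 < \<delta>"
    and two_point: "\<And>u v. \<lbrakk>0 \<le> u; u \<le> 1; 0 \<le> v; v \<le> 1\<rbrakk> \<Longrightarrow>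
      two_point_sum (1 - \<delta>) u v \<le> 2 powr \<delta> + \<delta> * m powr (1 - 1 / \<delta>)"
    and dense: "2 powr (- L) * (real (card \<A>) * real (card \<B>)) < real (card (disjoint_pairs \<A> \<B>))"
  shows "real (card \<A>) * real (card \<B>)
    < 2 powr (L / \<delta>) * 2 ^ n * exp (n * m powr (1 - 1 / \<delta>))"
proof -
  define M where "M = m powr (1 - 1 / \<delta>)"
  define P where "P = real (card \<A>) * real (card \<B>)"
  define K where "K = 2 powr \<delta> + \<delta> * M"
  define X where "X = 2 powr (L / \<delta>) * 2 ^ n * exp (n * M)"
  have M: "0 \<le> M" by (simp add: M_def)
  \<comment> \<open>The strict density bound forces a disjoint pair to exist, so
    \<open>P > 0\<close> and powers of \<open>P\<close> can be divided out.\<close>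
  have "0 < card (disjoint_pairs \<A> \<B>)"
    using dense by (intro gr0I) (auto simp: mult_less_0_iff)
  moreover have "finite \<A>" "finite \<B>"
    using sub by (auto elim: finite_subset)
  then have "card (disjoint_pairs \<A> \<B>) \<le> card \<A> * card \<B>"
    by (rule card_disjoint_pairs_le_product)
  ultimately have P: "0 < P"
    by (metis P_def less_le_trans of_nat_0_less_iff of_nat_mult)
  have "real (card (disjoint_pairs \<A> \<B>)) \<le> K ^ card {1..n} * P powr (1 - \<delta>)"
    unfolding P_def K_def M_def using sub two_point by (intro card_disjoint_pairs_le_powr) auto
  then have "2 powr (- L) * P < K ^ n * P powr (1 - \<delta>)"
    using dense by (simp add: P_def)
  then have less: "P powr \<delta> < 2 powr L * K ^ n"
    using P by (simp add: powr_diff powr_minus field_simps)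
  have "1 * (\<delta> * M) \<le> 2 powr \<delta> * (\<delta> * M)"
    using M \<delta> by (intro mult_right_mono ge_one_powr_ge_zero) auto
  then have "K \<le> 2 powr \<delta> * (1 + \<delta> * M)"
    by (simp add: K_def distrib_left)
  also have "\<dots> \<le> 2 powr \<delta> * exp (\<delta> * M)"
    by (intro mult_left_mono) auto
  finally have "K ^ n \<le> (2 powr \<delta> * exp (\<delta> * M)) ^ n"
    using M \<delta> by (intro power_mono) (auto simp: K_def)
  then have "2 powr L * K ^ n \<le> 2 powr L * (2 powr \<delta> * exp (\<delta> * M)) ^ n"
    by (intro mult_left_mono) auto
  also have "\<dots> = X powr \<delta>"
    using \<delta> by (simp add: X_def powr_mult powr_powr exp_powr_real power_mult_distrib powr_power
        mult_ac flip: powr_realpow exp_of_nat_mult)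
  finally have "P powr \<delta> < X powr \<delta>"
    using less by simp
  then have "P < X"
    using \<delta> powr_mono2[of \<delta> X P] by (auto simp: X_def not_le[symmetric])
  then show ?thesis by (simp add: P_def X_def M_def)
qed

section \<open>Choice of parameters and conclusion\<close>

theorem theorem1p3:
  fixes d c\<^sub>d \<eta> :: real
  assumes "d > 0" and "c\<^sub>d > 0" and "\<eta> > 0"
  shows "\<exists>n\<^sub>0::nat. \<forall>n\<ge>n\<^sub>0. \<forall>\<A> \<B> :: nat set set.
    \<A> \<subseteq> Pow {1..n} \<longrightarrow> \<B> \<subseteq> Pow {1..n} \<longrightarrow>
    real (card \<A>) * real (card \<B>) \<ge> c\<^sub>d * 2 ^ n * real n powr (2 * d) \<longrightarrow>
    real (card (disjoint_pairs \<A> \<B>))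
      \<le> (1 + \<eta>) * 2 powr (- 2 * d) * real (card \<A>) * real (card \<B>)"
proof -
  \<comment> \<open>The factor \<open>1 + \<eta>\<close> is absorbed into the exponent; the
    resulting slack \<open>L < 2 * d\<close> is what allows \<sigma> below 1.\<close>
  define L where "L = 2 * d - log 2 (1 + \<eta>)"
  have density: "2 powr (- L) = (1 + \<eta>) * 2 powr (- 2 * d)"
    using assms by (simp add: L_def powr_diff powr_minus field_simps)
  have "L < 2 * d"
    using assms by (simp add: L_def)
  moreover have "((\<lambda>\<sigma>. 2 * d * \<sigma>\<^sup>2) \<longlongrightarrow> 2 * d * 1\<^sup>2) (at_left 1)"
    by (intro tendsto_intros)
  ultimately have "\<forall>\<^sub>F \<sigma> in at_left 1. L < 2 * d * \<sigma>\<^sup>2"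
    by (intro order_tendstoD) auto
  moreover have "\<forall>\<^sub>F \<sigma>::real in at_left 1. 0 < \<sigma> \<and> \<sigma> < 1"
    using eventually_at_left_real[of 0 "1::real"] by simp
  ultimately have "\<forall>\<^sub>F \<sigma> in at_left 1. L < 2 * d * \<sigma>\<^sup>2 \<and> 0 < \<sigma> \<and> \<sigma> < 1"
    by eventually_elim auto
  then obtain \<sigma> where \<sigma>: "L < 2 * d * \<sigma>\<^sup>2" "0 < \<sigma>" "\<sigma> < 1"
    using eventually_happens trivial_limit_at_left_real by blast
  \<comment> \<open>This choice gives
    \<open>2 powr (L / \<delta> n) = n powr (L / \<sigma>\<^sup>2)\<close> and turns
    \<open>n * m powr (1 - 1 / \<delta> n)\<close> into a constant times
    \<open>n powr (1 - 1 / \<sigma>)\<close>.\<close>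
  define \<delta> where "\<delta> n = \<sigma>\<^sup>2 / log 2 (real n)" for n
  define m where "m = 2 powr \<sigma>"
  \<comment> \<open>Solves \<open>1 / (1 - w) = m\<close>; the range \<open>0 < \<sigma> < 1\<close>
    places \<open>w\<close> strictly between 0 and 1/2.\<close>
  define w where "w = 1 - 2 powr (- \<sigma>)"
  have "2 powr (- 1) < 2 powr (- \<sigma>)" "2 powr (- \<sigma>) < 2 powr (0::real)"
    using \<sigma> by (intro powr_less_mono; simp)+
  then have w: "0 < w" "w < 1/2" by (simp_all add: w_def powr_minus)
  have m_eq: "1 / (1 - w) = m"
    by (simp add: w_def m_def powr_minus_divide)
  have "filterlim \<delta> (at_right 0) sequentially"
    unfolding \<delta>_def using \<sigma> by real_asymp
  then have two_point: "\<forall>\<^sub>F n in sequentially. \<forall>u v. 0 \<le> u \<longrightarrow> u \<le> 1 \<longrightarrow> 0 \<le> v \<longrightarrow> v \<le> 1 \<longrightarrow>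
      two_point_sum (1 - \<delta> n) u v \<le> 2 powr \<delta> n + \<delta> n * m powr (1 - 1 / \<delta> n)"
    using eventually_two_point_sum_le[OF w] unfolding m_eq by (rule eventually_compose_filterlim[rotated])
  have "(\<lambda>n. exp (2 powr \<sigma> * real n powr e) * real n powr e') \<longlonglongrightarrow> 0" if "e < 0" "e' < 0" for e e'
    using that by real_asymp
  \<comment> \<open>The first sign comes from \<open>\<sigma> < 1\<close> and keeps the exponential
    bounded; the second comes from \<open>L < 2 * d * \<sigma>\<^sup>2\<close> and beats
    \<open>n powr (2 * d)\<close>.\<close>
  moreover have "1 - 1 / \<sigma> < 0" "L / \<sigma>\<^sup>2 - 2 * d < 0"
    using \<sigma> by (simp_all add: field_simps)
  ultimately have "(\<lambda>n. exp (2 powr \<sigma> * real n powr (1 - 1 / \<sigma>)) * real n powr (L / \<sigma>\<^sup>2 - 2 * d)) \<longlonglongrightarrow> 0"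
    by blast
  then have "\<forall>\<^sub>F n in sequentially.
      exp (2 powr \<sigma> * real n powr (1 - 1 / \<sigma>)) * real n powr (L / \<sigma>\<^sup>2 - 2 * d) < c\<^sub>d"
    using assms by (intro order_tendstoD) auto
  with two_point have "\<forall>\<^sub>F n in sequentially. \<forall>\<A> \<B> :: nat set set.
    \<A> \<subseteq> Pow {1..n} \<longrightarrow> \<B> \<subseteq> Pow {1..n} \<longrightarrow>
    real (card \<A>) * real (card \<B>) \<ge> c\<^sub>d * 2 ^ n * real n powr (2 * d) \<longrightarrow>
    real (card (disjoint_pairs \<A> \<B>))
      \<le> (1 + \<eta>) * 2 powr (- 2 * d) * real (card \<A>) * real (card \<B>)"
    using eventually_gt_at_top[of 1]
  proof eventually_elim
    case (elim n)
    have n: "1 < real n" using elim by simp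
    then have \<delta>: "0 < \<delta> n" using \<sigma> by (simp add: \<delta>_def)
    have n_powr: "real n powr x = 2 powr (log 2 (real n) * x)" for x
      using n by (simp add: powr_def log_def)
    have e1: "2 powr (L / \<delta> n) = real n powr (L / \<sigma>\<^sup>2)"
      by (simp add: \<delta>_def n_powr mult.commute)
    have "n * m powr (1 - 1 / \<delta> n) = 2 powr (log 2 n) * 2 powr (\<sigma> * (1 - log 2 n / \<sigma>\<^sup>2))"
      using n by (simp add: m_def \<delta>_def powr_powr)
    also have "\<dots> = 2 powr (log 2 n + \<sigma> * (1 - log 2 n / \<sigma>\<^sup>2))"
      by (simp add: powr_add)
    also have "log 2 n + \<sigma> * (1 - log 2 n / \<sigma>\<^sup>2) = \<sigma> + log 2 n * (1 - 1 / \<sigma>)"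
      using \<sigma> by (simp add: field_simps power2_eq_square)
    also have "2 powr \<dots> = 2 powr \<sigma> * real n powr (1 - 1 / \<sigma>)"
      by (simp add: n_powr powr_add)
    finally have e2: "n * m powr (1 - 1 / \<delta> n) = 2 powr \<sigma> * real n powr (1 - 1 / \<sigma>)" .
    show ?case
    proof (intro allI impI)
      fix \<A> \<B> :: "nat set set"
      assume sub: "\<A> \<subseteq> Pow {1..n}" "\<B> \<subseteq> Pow {1..n}"
        and large: "real (card \<A>) * real (card \<B>) \<ge> c\<^sub>d * 2 ^ n * real n powr (2 * d)"
      show "real (card (disjoint_pairs \<A> \<B>))
          \<le> (1 + \<eta>) * 2 powr (- 2 * d) * real (card \<A>) * real (card \<B>)"
      proof (rule ccontr)
        assume "\<not> ?thesis"
        then have "2 powr (- L) * (real (card \<A>) * real (card \<B>)) < real (card (disjoint_pairs \<A> \<B>))"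
          unfolding density by (simp add: mult.assoc)
        then have "real (card \<A>) * real (card \<B>)
            < 2 powr (L / \<delta> n) * 2 ^ n * exp (n * m powr (1 - 1 / \<delta> n))"
          using elim(1) sub \<delta> by (intro card_product_less) auto
        \<comment> \<open>Factoring out \<open>2 ^ n * n powr (2 * d)\<close> leaves the null
          sequence that is already below \<open>c\<^sub>d\<close>.\<close>
        also have "\<dots> = (exp (2 powr \<sigma> * real n powr (1 - 1 / \<sigma>)) * real n powr (L / \<sigma>\<^sup>2 - 2 * d))
            * (2 ^ n * real n powr (2 * d))"
          unfolding e1 e2 using n by (simp add: powr_diff)
        also have "\<dots> < c\<^sub>d * (2 ^ n * real n powr (2 * d))"
          using elim n by (intro mult_strict_right_mono) auto
        finally show False using large by (simp add: mult.assoc)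
      qed
    qed
  qed
  then show ?thesis
    unfolding eventually_sequentially .
qed

end
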